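(* Let $1\le\alpha\le N$ and $(a_1,\dots,a_\alpha)\in\mathbb Z^\alpha$. The quantum determinant of the matrix $(M_{a_j+i-j})_{1\le i,j\le\alpha}$ is $$\Big|\big(M_{a_j+i-j}\big)_{1\le i,j\le\alpha}\Big|_q=\sum_{A\in ASM_\alpha}(-q)^{I(A)-N(A)}(1-q)^{N(A)}\prod_{i=1}^\alpha M_{a_i+\alpha-i-m_i(A)},$$ where the products are ordered, $\prod_{i=1}^\alpha M_{b_i}=M_{b_1}M_{b_2}\cdots M_{b_\alpha}$.
   Context: $q$ is an indeterminate; $\Gamma_i$ is the shift $x_i\mapsto qx_i$ on functions of $x_1,\dots,x_N$. For $n\in\mathbb Z$, $M_n=\sum_{i=1}^Nx_i^n\prod_{j\ne i}\frac{x_i}{x_i-x_j}\Gamma_i$, acting on symmetric rational functions of $x_1,\dots,x_N$, and $m(u)=\sum_{n\in\mathbb Z}u^nM_n$. The quantum determinant is defined as $$\Big|\big(M_{a_j+i-j}\big)_{1\le i,j\le\alpha}\Big|_q:=CT_{\mathbf u}\Big(\prod_{i=1}^\alpha u_i^{-a_i}\prod_{1\le i<j\le\alpha}\Big(1-q\frac{u_j}{u_i}\Big)\,m(u_1)m(u_2)\cdots m(u_\alpha)\Big),$$ where $CT_{\mathbf u}$ is the coefficient of $u_1^0\cdots u_\alpha^0$. (It coincides with the operator $M_{a_1,\dots,a_\alpha}=\lim_{t\to\infty}t^{-\alpha(N-\alpha)}\mathcal M_{a_1,\dots,a_\alpha}=\sum_{|I|=\alpha}s_{a_1,\dots,a_\alpha}(\mathbf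 x_I)\prod_{i\in I,j\notin I}\frac{x_i}{x_i-x_j}\prod_{i\in I}\Gamma_i$, where $s_{a_1,\dots,a_\alpha}(x_1,\dots,x_\alpha)=\det(x_i^{a_j+\alpha-j})/\prod_{i<j}(x_i-x_j)$.) $ASM_\alpha$ is the set of $\alpha\times\alpha$ alternating sign matrices: matrices with entries in $\{0,1,-1\}$, each row and column summing to $1$, with nonzero entries alternating in sign along each row and column. For $A\in ASM_\alpha$: $I(A)=\sum_{i>k,\ j<\ell}A_{i,j}A_{k,\ell}$ is the inversion number; $N(A)$ is the number of entries equal to $-1$; $m_i(A)=(Av)_i$ with $v=(\alpha-1,\alpha-2,\dots,1,0)^t$. *)

theory Defs
  imports
    "HOL-Library.Poly_Mapping"
    "HOL-Computational_Algebra.Polynomial_Factorial"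
    "HOL-Combinatorics.Permutations"
    "Jordan_Normal_Form.Matrix"
begin

text \<open>
  All indices are 0-based: the variables are \<open>x\<^sub>0, \<dots>, x\<^sub>N\<^sub>-\<^sub>1\<close>, and the indices
  \<open>1 \<le> i \<le> \<alpha>\<close> of the sequences and matrices become \<open>0 \<le> i < \<alpha>\<close>.
\<close>

section \<open>Rational functions with an indeterminate q in the ground field\<close>

text \<open>
  The ground field \<open>k(q)\<close> is \<open>'k poly fract\<close>.  A polynomial is a finitely supported map from
  exponent vectors to coefficients.  The type \<open>'k ratfun\<close> has infinitely many variables;
  \<open>ratfuns N\<close> below is its subfield \<open>k(q)(x\<^sub>0, \<dots>, x\<^sub>N\<^sub>-\<^sub>1)\<close>.
\<close>

type_synonym 'k mpol = "(nat \<Rightarrow>\<^sub>0 nat) \<Rightarrow>\<^sub>0 'k poly fract"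
type_synonym 'k ratfun = "((nat \<Rightarrow>\<^sub>0 nat) \<Rightarrow>\<^sub>0 'k poly fract) fract"

definition q_var :: "'k::field_char_0 poly fract" where
  "q_var = to_fract [:0, 1:]"

definition rf_const :: "'k::field_char_0 poly fract \<Rightarrow> 'k ratfun" where
  "rf_const c = to_fract (Poly_Mapping.single 0 c)"

definition rf_var :: "nat \<Rightarrow> 'k::field_char_0 ratfun" where
  "rf_var i = to_fract (Poly_Mapping.single (Poly_Mapping.single i 1) 1)"

definition poly_eval :: "(nat \<Rightarrow> 'k::field_char_0 ratfun) \<Rightarrow> 'k mpol \<Rightarrow> 'k ratfun" where
  "poly_eval \<sigma> p = (\<Sum>m\<in>Poly_Mapping.keys p. rf_const (Poly_Mapping.lookup p m) *
     (\<Prod>i\<in>Poly_Mapping.keys m. \<sigma> i ^ Poly_Mapping.lookup m i))"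

text \<open>
  Substitution \<open>x\<^sub>i \<mapsto> \<sigma> i\<close> in a rational function.  The value does not depend on the chosen
  fraction (\<open>rf_subst_Fract\<close>), and every fraction qualifies when the variables are rescaled by
  nonzero constants and renamed injectively (\<open>poly_eval_rescale_nonzero\<close>), which is the only case
  used.
\<close>

definition rf_subst :: "(nat \<Rightarrow> 'k::field_char_0 ratfun) \<Rightarrow> 'k ratfun \<Rightarrow> 'k ratfun" where
  "rf_subst \<sigma> f = (THE g. \<exists>p r. f = Fract p r \<and> poly_eval \<sigma> r \<noteq> 0 \<and>
     g = poly_eval \<sigma> p / poly_eval \<sigma> r)"

definition ratfuns :: "nat \<Rightarrow> 'k::field_char_0 ratfun set" where
  "ratfuns N = {Fract p r | p r. r \<noteq> 0 \<and>
     (\<forall>m\<in>Poly_Mapping.keys p \<union> Poly_Mapping.keys r. Poly_Mapping.keys m \<subseteq> {..<N})}"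

definition sym_ratfuns :: "nat \<Rightarrow> 'k::field_char_0 ratfun set" where
  "sym_ratfuns N = {f \<in> ratfuns N. \<forall>\<pi>. \<pi> permutes {..<N} \<longrightarrow> rf_subst (\<lambda>i. rf_var (\<pi> i)) f = f}"

lemma rf_const_simps:
  "rf_const 0 = 0" "rf_const 1 = 1"
  "rf_const (c + d) = rf_const c + rf_const d"
  "rf_const (c * d) = rf_const c * rf_const d"
  unfolding rf_const_def
  by (simp_all add: single_add mult_single flip: to_fract_add to_fract_mult)

lemma poly_eval_superset:
  assumes "finite S" "Poly_Mapping.keys p \<subseteq> S"
  shows "poly_eval \<sigma> p = (\<Sum>m\<in>S. rf_const (Poly_Mapping.lookup p m) *
     (\<Prod>i\<in>Poly_Mapping.keys m. \<sigma> i ^ Poly_Mapping.lookup m i))"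
  unfolding poly_eval_def using assms
  by (intro sum.mono_neutral_left) (auto simp: in_keys_iff rf_const_simps)

lemma poly_eval_0: "poly_eval \<sigma> 0 = 0"
  by (simp add: poly_eval_def)

lemma poly_eval_single: "poly_eval \<sigma> (Poly_Mapping.single m c) =
    rf_const c * (\<Prod>i\<in>Poly_Mapping.keys m. \<sigma> i ^ Poly_Mapping.lookup m i)"
  by (subst poly_eval_superset[where S="{m}"]) auto

lemma poly_eval_add: "poly_eval \<sigma> (p + r) = poly_eval \<sigma> p + poly_eval \<sigma> r"
proof -
  let ?S = "Poly_Mapping.keys p \<union> Poly_Mapping.keys r"
  have "Poly_Mapping.keys (p + r) \<subseteq> ?S" by (rule Poly_Mapping.keys_add)
  then show ?thesis
    by (simp add: poly_eval_superset[where S="?S"] lookup_add rf_const_simps algebra_simps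
        sum.distrib)
qed

lemma monom_eval_add:
  fixes \<sigma> :: "nat \<Rightarrow> 'k::field_char_0 ratfun"
  shows "(\<Prod>i\<in>Poly_Mapping.keys (m + n). \<sigma> i ^ Poly_Mapping.lookup (m + n) i) =
    (\<Prod>i\<in>Poly_Mapping.keys m. \<sigma> i ^ Poly_Mapping.lookup m i) *
    (\<Prod>i\<in>Poly_Mapping.keys n. \<sigma> i ^ Poly_Mapping.lookup n i)"
proof -
  let ?S = "Poly_Mapping.keys m \<union> Poly_Mapping.keys n"
  have *: "(\<Prod>i\<in>Poly_Mapping.keys k. \<sigma> i ^ Poly_Mapping.lookup k i) =
      (\<Prod>i\<in>?S. \<sigma> i ^ Poly_Mapping.lookup k i)" if "Poly_Mapping.keys k \<subseteq> ?S" for k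
    using that by (intro prod.mono_neutral_left) (auto simp: in_keys_iff)
  have "(\<Prod>i\<in>Poly_Mapping.keys (m + n). \<sigma> i ^ Poly_Mapping.lookup (m + n) i) =
      (\<Prod>i\<in>?S. \<sigma> i ^ Poly_Mapping.lookup m i * \<sigma> i ^ Poly_Mapping.lookup n i)"
    using *[of "m + n"] Poly_Mapping.keys_add[of m n] by (simp only: lookup_add power_add)
  also have "\<dots> = (\<Prod>i\<in>?S. \<sigma> i ^ Poly_Mapping.lookup m i) *
      (\<Prod>i\<in>?S. \<sigma> i ^ Poly_Mapping.lookup n i)"
    by (rule prod.distrib)
  finally show ?thesis
    using *[of m] *[of n] by (simp only: Un_upper1 Un_upper2)
qed

lemma mpol_induct [case_names zero add_single]:
  fixes p :: "'a::monoid_add \<Rightarrow>\<^sub>0 'b::comm_monoid_add"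
  assumes "P 0" and add: "\<And>p m c. P p \<Longrightarrow> P (p + Poly_Mapping.single m c)"
  shows "P p"
proof (induction p rule: update_induct)
  case const
  show ?case by fact
next
  case (update p m c)
  have "Poly_Mapping.update m c p = p + Poly_Mapping.single m c"
    using update.hyps
    by (intro poly_mapping_eqI) (auto simp: lookup_update lookup_add lookup_single when_def in_keys_iff)
  then show ?case using add[OF update.IH] by simp
qed

lemma poly_eval_mult: "poly_eval \<sigma> (p * r) = poly_eval \<sigma> p * poly_eval \<sigma> r"
proof (induction p rule: mpol_induct)
  case zero
  show ?case by (simp add: poly_eval_0)
next
  case (add_single p m c)
  have "poly_eval \<sigma> (Poly_Mapping.single m c * r) = poly_eval \<sigma> (Poly_Mapping.single m c) * poly_eval \<sigma> r"
  proof (induction r rule: mpol_induct)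
    case zero
    show ?case by (simp add: poly_eval_0)
  next
    case (add_single r n d)
    then show ?case
      by (simp add: distrib_left poly_eval_add mult_single poly_eval_single monom_eval_add
          rf_const_simps mult_ac)
  qed
  with add_single show ?case by (simp add: distrib_right poly_eval_add)
qed

lemma rf_subst_Fract:
  assumes "poly_eval \<sigma> r \<noteq> 0"
  shows "rf_subst \<sigma> (Fract p r) = poly_eval \<sigma> p / poly_eval \<sigma> r"
  unfolding rf_subst_def
proof (rule the_equality)
  show "\<exists>p' r'. Fract p r = Fract p' r' \<and> poly_eval \<sigma> r' \<noteq> 0 \<and>
      poly_eval \<sigma> p / poly_eval \<sigma> r = poly_eval \<sigma> p' / poly_eval \<sigma> r'"
    using assms by blast
next
  fix g
  assume "\<exists>p' r'. Fract p r = Fract p' r' \<and> poly_eval \<sigma> r' \<noteq> 0 \<and>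
      g = poly_eval \<sigma> p' / poly_eval \<sigma> r'"
  then obtain p' r' where eq: "Fract p r = Fract p' r'" and nz: "poly_eval \<sigma> r' \<noteq> 0"
    and g: "g = poly_eval \<sigma> p' / poly_eval \<sigma> r'" by blast
  have "r \<noteq> 0" "r' \<noteq> 0" using assms nz by (auto simp: poly_eval_0)
  with eq have "p * r' = p' * r" by (simp add: eq_fract)
  then have "poly_eval \<sigma> p * poly_eval \<sigma> r' = poly_eval \<sigma> p' * poly_eval \<sigma> r"
    by (metis poly_eval_mult)
  then show "g = poly_eval \<sigma> p / poly_eval \<sigma> r"
    unfolding g frac_eq_eq[OF nz assms] by simp
qed

lemma poly_eval_rescale_nonzero:
  fixes r :: "'k::field_char_0 mpol"
  assumes \<pi>: "inj \<pi>" and c: "\<And>i. c i \<noteq> 0" and r: "r \<noteq> 0"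
  shows "poly_eval (\<lambda>i. rf_const (c i) * rf_var (\<pi> i)) r \<noteq> 0"
proof -
  define ren where "ren m = (\<Sum>i\<in>Poly_Mapping.keys m.
    Poly_Mapping.single (\<pi> i) (Poly_Mapping.lookup m i))" for m :: "nat \<Rightarrow>\<^sub>0 nat"
  define w where "w m = (\<Prod>i\<in>Poly_Mapping.keys m. c i ^ Poly_Mapping.lookup m i)"
    for m :: "nat \<Rightarrow>\<^sub>0 nat"
  have pow: "Poly_Mapping.single k a ^ e = Poly_Mapping.single (of_nat e * k) (a ^ e)"
    for k :: "nat \<Rightarrow>\<^sub>0 nat" and a :: "'k poly fract" and e
    by (induction e) (simp_all add: mult_single algebra_simps)
  have nk: "of_nat e * Poly_Mapping.single k (Suc 0) = Poly_Mapping.single k e" for e k :: nat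
    by (induction e) (simp_all add: distrib_right flip: single_add)
  have prod_single: "(\<Prod>i\<in>S. Poly_Mapping.single (g i) (h i)) =
      Poly_Mapping.single (\<Sum>i\<in>S. g i) (\<Prod>i\<in>S. h i)" if "finite S"
    for S :: "nat set" and g :: "nat \<Rightarrow> nat \<Rightarrow>\<^sub>0 nat" and h :: "nat \<Rightarrow> 'k poly fract"
    using that by (induction S) (simp_all add: mult_single)
  have tp: "to_fract (x ^ n) = to_fract x ^ n" for x :: "'k mpol" and n
    by (induction n) (simp_all add: to_fract_mult)
  have tprod: "to_fract (\<Prod>i\<in>S. g i) = (\<Prod>i\<in>S. to_fract (g i))"
    for S :: "nat set" and g :: "nat \<Rightarrow> 'k mpol"
    by (induction S rule: infinite_finite_induct) (simp_all add: to_fract_mult)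
  have tsum: "to_fract (\<Sum>i\<in>S. g i) = (\<Sum>i\<in>S. to_fract (g i))"
    for S :: "(nat \<Rightarrow>\<^sub>0 nat) set" and g :: "_ \<Rightarrow> 'k mpol"
    by (induction S rule: infinite_finite_induct) (simp_all add: to_fract_add)
  have factor: "(rf_const (c i) * rf_var (\<pi> i)) ^ e =
      to_fract (Poly_Mapping.single (Poly_Mapping.single (\<pi> i) e) (c i ^ e))" for i e
    unfolding rf_const_def rf_var_def to_fract_mult[symmetric] tp[symmetric] mult_single pow
    by (simp add: nk)
  have mon: "(\<Prod>i\<in>Poly_Mapping.keys m.
      (rf_const (c i) * rf_var (\<pi> i)) ^ Poly_Mapping.lookup m i) =
      to_fract (Poly_Mapping.single (ren m) (w m))" for m
    unfolding ren_def w_def factor tprod[symmetric] by (simp add: prod_single)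
  have ev: "poly_eval (\<lambda>i. rf_const (c i) * rf_var (\<pi> i)) r = to_fract
      (\<Sum>m\<in>Poly_Mapping.keys r. Poly_Mapping.single (ren m) (Poly_Mapping.lookup r m * w m))"
    unfolding poly_eval_def mon tsum
    by (intro sum.cong refl) (simp only: rf_const_def mult_single add_0 flip: to_fract_mult)
  have ren_lookup: "Poly_Mapping.lookup (ren m) (\<pi> j) = Poly_Mapping.lookup m j" for m j
  proof -
    have "Poly_Mapping.lookup (ren m) (\<pi> j) =
        (\<Sum>i\<in>Poly_Mapping.keys m. if i = j then Poly_Mapping.lookup m i else 0)"
      unfolding ren_def lookup_sum
      by (intro sum.cong) (auto simp: lookup_single when_def inj_eq[OF \<pi>])
    then show ?thesis by (simp add: in_keys_iff)
  qed
  have ren_inj: "ren m = ren n \<longleftrightarrow> m = n" for m n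
  proof
    assume eq: "ren m = ren n"
    show "m = n"
    proof (rule poly_mapping_eqI)
      fix j
      show "Poly_Mapping.lookup m j = Poly_Mapping.lookup n j"
        using ren_lookup[of m j] ren_lookup[of n j] eq by (metis (no_types))
    qed
  qed simp
  from r obtain m where m: "m \<in> Poly_Mapping.keys r" by fastforce
  have "Poly_Mapping.lookup (\<Sum>n\<in>Poly_Mapping.keys r. Poly_Mapping.single (ren n)
      (Poly_Mapping.lookup r n * w n)) (ren m) =
      (\<Sum>n\<in>Poly_Mapping.keys r. if n = m then Poly_Mapping.lookup r n * w n else 0)"
    unfolding lookup_sum
    by (intro sum.cong) (auto simp: lookup_single when_def ren_inj)
  also have "\<dots> = Poly_Mapping.lookup r m * w m" using m by simp
  also have "\<dots> \<noteq> 0" using m c by (simp add: w_def in_keys_iff)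
  finally show ?thesis unfolding ev to_fract_eq_0_iff by (rule contrapos_nn) simp
qed

section \<open>The operators M and the quantum determinant\<close>

definition q_shift :: "nat \<Rightarrow> 'k::field_char_0 ratfun \<Rightarrow> 'k ratfun" where
  "q_shift i = rf_subst (rf_var(i := rf_const q_var * rf_var i))"

lemma q_shift_Fract:
  assumes "r \<noteq> 0"
  shows "q_shift i (Fract p r) =
    poly_eval (rf_var(i := rf_const q_var * rf_var i)) p /
    poly_eval (rf_var(i := rf_const q_var * rf_var i)) r"
proof -
  have "rf_var(i := rf_const q_var * rf_var i) =
      (\<lambda>j. rf_const (if j = i then q_var else 1) * rf_var (id j) :: 'a ratfun)"
    by (auto simp: fun_eq_iff rf_const_simps)
  moreover have "q_var \<noteq> (0 :: 'a poly fract)" by (simp add: q_var_def)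
  ultimately show ?thesis
    unfolding q_shift_def using assms
    by (intro rf_subst_Fract) (simp only:, intro poly_eval_rescale_nonzero, auto)
qed

definition M_op :: "nat \<Rightarrow> int \<Rightarrow> 'k::field_char_0 ratfun \<Rightarrow> 'k ratfun" where
  "M_op N n f = (\<Sum>i<N. rf_var i powi n *
     (\<Prod>j\<in>{..<N} - {i}. rf_var i / (rf_var i - rf_var j)) * q_shift i f)"

definition M_prod :: "nat \<Rightarrow> nat \<Rightarrow> (nat \<Rightarrow> int) \<Rightarrow> 'k::field_char_0 ratfun \<Rightarrow> 'k ratfun" where
  "M_prod N \<alpha> b = foldr (\<circ>) (map (\<lambda>i. M_op N (b i)) [0..<\<alpha>]) id"

text \<open>
  Laurent polynomials in \<open>u\<^sub>0, u\<^sub>1, \<dots>\<close> over \<open>k(q)\<close> are finitely supported, while formal series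
  infinite in both directions, with operators as coefficients, are arbitrary functions of the
  exponent vector.
\<close>

type_synonym 'k laurent = "(nat \<Rightarrow>\<^sub>0 int) \<Rightarrow>\<^sub>0 'k poly fract"
type_synonym 'k op_series = "(nat \<Rightarrow>\<^sub>0 int) \<Rightarrow> 'k ratfun \<Rightarrow> 'k ratfun"

definition u_pow :: "nat \<Rightarrow> int \<Rightarrow> 'k::field_char_0 laurent" where
  "u_pow i e = Poly_Mapping.single (Poly_Mapping.single i e) 1"

definition laurent_times :: "'k::field_char_0 laurent \<Rightarrow> 'k op_series \<Rightarrow> 'k op_series" where
  "laurent_times P D = (\<lambda>n f. \<Sum>k\<in>Poly_Mapping.keys P.
     rf_const (Poly_Mapping.lookup P k) * D (n - k) f)"

definition CT :: "'k::field_char_0 op_series \<Rightarrow> 'k ratfun \<Rightarrow> 'k ratfun" where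
  "CT D = D 0"

text \<open>
  The product \<open>m(u\<^sub>0) m(u\<^sub>1) \<cdots> m(u\<^sub>\<alpha>\<^sub>-\<^sub>1)\<close> of the series \<open>m(u) = (\<Sum>n. u\<^sup>n M\<^sub>n)\<close> in distinct
  variables: the coefficient of \<open>u\<^sub>0\<^bsup>n\<^sub>0\<^esup> \<cdots> u\<^sub>\<alpha>\<^sub>-\<^sub>1\<^bsup>n\<^sub>\<alpha>\<^sub>-\<^sub>1\<^esup>\<close> is the composite of the \<open>M\<^bsub>n\<^sub>i\<^esub>\<close> in the
  order of the indices, and no other variable occurs.
\<close>

definition m_product :: "nat \<Rightarrow> nat \<Rightarrow> 'k::field_char_0 op_series" where
  "m_product N \<alpha> n = (if Poly_Mapping.keys n \<subseteq> {..<\<alpha>}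
     then M_prod N \<alpha> (Poly_Mapping.lookup n) else (\<lambda>f. 0))"

definition qdet_kernel :: "nat \<Rightarrow> (nat \<Rightarrow> int) \<Rightarrow> 'k::field_char_0 laurent" where
  "qdet_kernel \<alpha> a = (\<Prod>i<\<alpha>. u_pow i (- a i)) *
     (\<Prod>(i, j)\<in>{(i, j). i < j \<and> j < \<alpha>}.
        1 - Poly_Mapping.single 0 q_var * u_pow j 1 * u_pow i (-1))"

text \<open>The quantum determinant of the matrix with entries \<open>M\<^bsub>a\<^sub>j + i - j\<^esub>\<close>.\<close>

definition qdet :: "nat \<Rightarrow> nat \<Rightarrow> (nat \<Rightarrow> int) \<Rightarrow> 'k::field_char_0 ratfun \<Rightarrow> 'k ratfun" where
  "qdet N \<alpha> a = CT (laurent_times (qdet_kernel \<alpha> a) (m_product N \<alpha>))"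

section \<open>Alternating sign matrices\<close>

definition alternating :: "nat \<Rightarrow> (nat \<Rightarrow> int) \<Rightarrow> bool" where
  "alternating n v \<longleftrightarrow> (\<forall>j k. j < k \<and> k < n \<and> v j \<noteq> 0 \<and> v k \<noteq> 0 \<and>
     (\<forall>l. j < l \<and> l < k \<longrightarrow> v l = 0) \<longrightarrow> sgn (v k) = - sgn (v j))"

definition ASM :: "nat \<Rightarrow> int mat set" where
  "ASM n = {A \<in> carrier_mat n n.
     (\<forall>i<n. \<forall>j<n. A $$ (i, j) \<in> {0, 1, -1}) \<and>
     (\<forall>i<n. (\<Sum>j<n. A $$ (i, j)) = 1) \<and>
     (\<forall>j<n. (\<Sum>i<n. A $$ (i, j)) = 1) \<and>
     (\<forall>i<n. alternating n (\<lambda>j. A $$ (i, j))) \<and>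
     (\<forall>j<n. alternating n (\<lambda>i. A $$ (i, j)))}"

definition inv_number :: "nat \<Rightarrow> int mat \<Rightarrow> int" where
  "inv_number n A = (\<Sum>(i, j, k, l)\<in>{(i, j, k, l). i < n \<and> l < n \<and> k < i \<and> j < l}.
     A $$ (i, j) * A $$ (k, l))"

definition neg_count :: "nat \<Rightarrow> int mat \<Rightarrow> nat" where
  "neg_count n A = card {(i, j). i < n \<and> j < n \<and> A $$ (i, j) = -1}"

definition m_vec :: "nat \<Rightarrow> int mat \<Rightarrow> int vec" where
  "m_vec n A = A *\<^sub>v vec n (\<lambda>j. int n - 1 - int j)"

end

(* The claim is the lambda-determinant formula of Mills, Robbins and Rumsey,
   prod_(i<j) (x_i + l x_j) = sum_A l^(I(A)-N(A)) (1+l)^N(A) prod_i x_i^(m_i(A)),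
   at l = -q and x_i = u_i: multiplying it by a Laurent monomial and taking the constant term
   against m(u_1) ... m(u_alpha) turns every x-monomial into a product of operators M_n.

   The right-hand side is the partition function of a six-vertex model.  A state is the 0/1 vector
   of the column sums of the first rows of A, a row of A acts by a transfer matrix T_l(y), and the
   partial sums along the row form a 0/1 "carry".  The weights are free fermionic: psi(x) = T_(-1)(x)
   satisfies (y - x) T_l(y) psi(x) = (x + l y) psi(x) T_l(y), and T_l(y) and psi(y) agree on the
   empty state.  So T_l(x_n) ... T_l(x_1) applied to the empty state is, up to the factor
   prod (x_i + l x_j) / prod (x_j - x_i), independent of l.  At l = 0 the identity matrix alone
   contributes to the full state, which fixes the constant. *)

theory Submission
  imports Defs
begin

section \<open>The transfer matrix\<close>

text \<open>Besides the state, the argument \<open>c\<close> is the carry entering from the left; the carry must leave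
  at the right end.\<close>

fun transfer :: "'r::comm_ring_1 \<Rightarrow> 'r \<Rightarrow> bool \<Rightarrow> (bool list \<Rightarrow> 'r) \<Rightarrow> bool list \<Rightarrow> 'r" where
  "transfer l y c F [] = (if c then F [] else 0)"
| "transfer l y False F (False # t) = transfer l y False (\<lambda>s. F (False # s)) t"
| "transfer l y False F (True # t) =
     transfer l y False (\<lambda>s. F (True # s)) t + transfer l y True (\<lambda>s. F (False # s)) t"
| "transfer l y True F (False # t) = y * transfer l y True (\<lambda>s. F (False # s)) t +
     y * (1 + l) * transfer l y False (\<lambda>s. F (True # s)) t"
| "transfer l y True F (True # t) = l * y * transfer l y True (\<lambda>s. F (True # s)) t"

lemma transfer_add: "transfer l y c (\<lambda>s. F s + G s) t = transfer l y c F t + transfer l y c G t"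
  by (induction l y c F t arbitrary: G rule: transfer.induct) (simp_all, simp_all add: algebra_simps)

lemma transfer_cmult: "transfer l y c (\<lambda>s. k * F s) t = k * transfer l y c F t"
  by (induction l y c F t rule: transfer.induct) (simp_all add: algebra_simps)

lemma transfer_minus: "transfer l y c (\<lambda>s. - F s) t = - transfer l y c F t"
  using transfer_cmult[of l y c "-1" F t] by simp

text \<open>The four carry cases are the entries of the R-matrix, found by solving for the relations that
  survive adding one column.\<close>
lemma transfer_exchange_carry:
  fixes l x y :: "'r::comm_ring_1"
  defines "A \<equiv> \<lambda>c d F s. transfer l y c (transfer (-1) x d F) s"
    and "B \<equiv> \<lambda>c d F s. transfer (-1) x d (transfer l y c F) s"
  shows "A False True F s = - B False True F s"
    and "A True True F s = B True True F s"
    and "(y - x) * A True False F s = y * (1 + l) * B False True F s + (x + l * y) * B True False F s"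
    and "(y - x) * A False False F s = (x + l * y) * B False False F s"
proof -
  have lin: "transfer l' y' c (\<lambda>s. F s + G s) = (\<lambda>t. transfer l' y' c F t + transfer l' y' c G t)"
    "transfer l' y' c (\<lambda>s. k * F s) = (\<lambda>t. k * transfer l' y' c F t)"
    "transfer l' y' c (\<lambda>s. - F s) = (\<lambda>t. - transfer l' y' c F t)"
    for l' y' k :: 'r and c F G
    by (auto simp: transfer_add transfer_cmult transfer_minus)
  have "A False True F s = - B False True F s \<and> A True True F s = B True True F s \<and>
    (y - x) * A True False F s = y * (1 + l) * B False True F s + (x + l * y) * B True False F s \<and>
    (y - x) * A False False F s = (x + l * y) * B False False F s"
  proof (induction s arbitrary: F)
    case Nil
    show ?case by (simp add: A_def B_def)
  next
    case (Cons b t)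
    \<comment> \<open>Peeling off the first column expresses each two-row composite through the same
      four composites on the tail \<open>t\<close>, applied to \<open>F\<close> with the first bit
      of its argument fixed.\<close>
    have A:
      "A False False F (False # t) = A False False (\<lambda>s. F (False # s)) t"
      "A False True F (False # t) = x * A False True (\<lambda>s. F (False # s)) t"
      "A True False F (False # t) = y * A True False (\<lambda>s. F (False # s)) t +
        y * (1 + l) * (A False False (\<lambda>s. F (True # s)) t + A False True (\<lambda>s. F (False # s)) t)"
      "A True True F (False # t) = x * y * A True True (\<lambda>s. F (False # s)) t
         - x * y * (1 + l) * A False True (\<lambda>s. F (True # s)) t"
      "A False False F (True # t) = A False False (\<lambda>s. F (True # s)) t
         + A False True (\<lambda>s. F (False # s)) t + A True False (\<lambda>s. F (False # s)) t"
      "A False True F (True # t) = - x * A False True (\<lambda>s. F (True # s)) t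
         + x * A True True (\<lambda>s. F (False # s)) t"
      "A True False F (True # t) = l * y * (A True False (\<lambda>s. F (True # s)) t
         + A True True (\<lambda>s. F (False # s)) t)"
      "A True True F (True # t) = - l * x * y * A True True (\<lambda>s. F (True # s)) t"
      unfolding A_def by (simp_all add: lin algebra_simps)
    have B:
      "B False False F (False # t) = B False False (\<lambda>s. F (False # s)) t"
      "B False True F (False # t) = x * B False True (\<lambda>s. F (False # s)) t"
      "B True False F (False # t) = y * B True False (\<lambda>s. F (False # s)) t +
        y * (1 + l) * B False False (\<lambda>s. F (True # s)) t"
      "B True True F (False # t) = x * y * B True True (\<lambda>s. F (False # s)) t
         + x * y * (1 + l) * B False True (\<lambda>s. F (True # s)) t"
      "B False False F (True # t) = B False False (\<lambda>s. F (True # s)) t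
         + B False True (\<lambda>s. F (False # s)) t + B True False (\<lambda>s. F (False # s)) t"
      "B False True F (True # t) = - x * (B False True (\<lambda>s. F (True # s)) t
         + B True True (\<lambda>s. F (False # s)) t)"
      "B True False F (True # t) = l * y * B True False (\<lambda>s. F (True # s)) t
         + y * B True True (\<lambda>s. F (False # s)) t
         + y * (1 + l) * B False True (\<lambda>s. F (True # s)) t"
      "B True True F (True # t) = - l * x * y * B True True (\<lambda>s. F (True # s)) t"
      unfolding B_def by (simp_all add: lin algebra_simps)
    let ?F0 = "\<lambda>s. F (False # s)" and ?F1 = "\<lambda>s. F (True # s)"
    have IH: "A False True G t = - B False True G t" "A True True G t = B True True G t"
      "(y - x) * A True False G t = y * (1 + l) * B False True G t + (x + l * y) * B True False G t"
      "(y - x) * A False False G t = (x + l * y) * B False False G t" for G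
      using Cons.IH by blast+
    show ?case
    proof (cases b rule: bool.exhaust)
      case True
      \<comment> \<open>The induction hypotheses control \<open>A True False\<close> and
        \<open>A False False\<close> only after multiplication by \<open>y - x\<close>, so that
        factor is distributed over the sum before rewriting.\<close>
      have "(y - x) * (l * y * (A True False ?F1 t + A True True ?F0 t)) =
          l * y * ((y - x) * A True False ?F1 t + (y - x) * A True True ?F0 t)"
        by (simp only: distrib_left mult_ac)
      moreover have "(y - x) * (A False False ?F1 t + A False True ?F0 t + A True False ?F0 t) =
          (y - x) * A False False ?F1 t + (y - x) * A False True ?F0 t + (y - x) * A True False ?F0 t"
        by (simp only: distrib_left)
      ultimately show ?thesis
        unfolding True A B IH by (simp add: algebra_simps)
    next
      case False
      have "(y - x) * (y * A True False ?F0 t + y * (1 + l) * (A False False ?F1 t + A False True ?F0 t)) =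
          y * ((y - x) * A True False ?F0 t) +
          y * (1 + l) * ((y - x) * A False False ?F1 t + (y - x) * A False True ?F0 t)"
        by (simp only: distrib_left mult_ac)
      then show ?thesis
        unfolding False A B IH by (simp add: algebra_simps)
    qed
  qed
  then show "A False True F s = - B False True F s"
    "A True True F s = B True True F s"
    "(y - x) * A True False F s = y * (1 + l) * B False True F s + (x + l * y) * B True False F s"
    "(y - x) * A False False F s = (x + l * y) * B False False F s" by blast+
qed

section \<open>The fermionic form of the state sum\<close>

definition vacuum :: "bool list \<Rightarrow> 'r::comm_ring_1" where
  "vacuum s = of_bool (True \<notin> set s)"

text \<open>A factor containing \<open>l\<close> occurs only on branches whose previous bit is
  \<open>True\<close>, and \<open>vacuum\<close> kills those branches.\<close>

lemma transfer_vacuum: "transfer l y c vacuum s = transfer l' y c vacuum s"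
proof -
  have *: "(\<lambda>s. vacuum (False # s)) = vacuum" "(\<lambda>s. vacuum (True # s)) = (\<lambda>s. 0)"
    by (auto simp: vacuum_def)
  have z: "transfer l y c (\<lambda>s. 0) t = 0" for l y c and t
    using transfer_cmult[of l y c 0 "\<lambda>_. 0" t] by simp
  show ?thesis
  proof (induction s arbitrary: c)
    case (Cons b s)
    then show ?case by (cases b; cases c) (simp_all add: * z)
  qed simp
qed

text \<open>The operator at \<open>y\<close> moves inward past one fermion at a time, each exchange
  trading \<open>y - x\<close> for \<open>x + l * y\<close>. On reaching \<open>vacuum\<close> it
  becomes the fermion at \<open>y\<close>, which is why \<open>y\<close> ends the list.\<close>

lemma transfer_through_fermions:
  "(\<Prod>x\<leftarrow>xs. y - x) * transfer l y False (foldr (\<lambda>x. transfer (-1) x False) xs vacuum) s =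
   (\<Prod>x\<leftarrow>xs. x + l * y) * foldr (\<lambda>x. transfer (-1) x False) (xs @ [y]) vacuum s"
proof (induction xs arbitrary: s)
  case Nil
  show ?case using transfer_vacuum by simp
next
  case (Cons x xs)
  let ?G = "foldr (\<lambda>x. transfer (-1) x False) xs vacuum"
  have "(\<Prod>x\<leftarrow>x # xs. y - x) * transfer l y False (transfer (-1) x False ?G) s =
     (\<Prod>x\<leftarrow>xs. y - x) * ((y - x) * transfer l y False (transfer (-1) x False ?G) s)"
    by (simp add: mult_ac)
  also have "\<dots> = (x + l * y) * ((\<Prod>x\<leftarrow>xs. y - x) * transfer (-1) x False (transfer l y False ?G) s)"
    unfolding transfer_exchange_carry(4) by (simp add: mult_ac)
  also have "\<dots> = (x + l * y) * transfer (-1) x False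
      (\<lambda>s. (\<Prod>x\<leftarrow>xs. y - x) * transfer l y False ?G s) s"
    by (simp add: transfer_cmult)
  also have "\<dots> = (\<Prod>x\<leftarrow>x # xs. x + l * y) * foldr (\<lambda>x. transfer (-1) x False) ((x # xs) @ [y]) vacuum s"
    unfolding Cons.IH by (simp add: transfer_cmult mult_ac)
  finally show ?case by simp
qed

primrec state_sum :: "'r::comm_ring_1 \<Rightarrow> (nat \<Rightarrow> 'r) \<Rightarrow> nat \<Rightarrow> bool list \<Rightarrow> 'r" where
  "state_sum l x 0 = vacuum"
| "state_sum l x (Suc m) = transfer l (x m) False (state_sum l x m)"

text \<open>The fermion product on the right is free of \<open>l\<close>, so state sums at two
  values of \<open>l\<close> can be compared. The identity is cross-multiplied because a general
  ring has no division.\<close>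

lemma state_sum_eq_fermions:
  "(\<Prod>j<m. \<Prod>i<j. x j - x i) * state_sum l x m s =
   (\<Prod>j<m. \<Prod>i<j. x i + l * x j) * foldr (\<lambda>x. transfer (-1) x False) (map x [0..<m]) vacuum s"
proof (induction m arbitrary: s)
  case 0
  show ?case by simp
next
  case (Suc m)
  let ?G = "foldr (\<lambda>x. transfer (-1) x False) (map x [0..<m]) vacuum"
  have pl: "(\<Prod>t\<leftarrow>map x [0..<m]. h t) = (\<Prod>i<m. h (x i))" for h :: "'a \<Rightarrow> 'a"
    by (induction m) (simp_all add: mult_ac)
  have "(\<Prod>j<Suc m. \<Prod>i<j. x j - x i) * state_sum l x (Suc m) s = (\<Prod>i<m. x m - x i) *
     transfer l (x m) False (\<lambda>s. (\<Prod>j<m. \<Prod>i<j. x j - x i) * state_sum l x m s) s"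
    unfolding transfer_cmult by (simp add: mult_ac)
  also have "\<dots> = (\<Prod>j<m. \<Prod>i<j. x i + l * x j) * ((\<Prod>i<m. x m - x i) * transfer l (x m) False ?G s)"
    unfolding Suc.IH by (simp only: transfer_cmult mult.left_commute)
  also have "(\<Prod>i<m. x m - x i) * transfer l (x m) False ?G s = (\<Prod>i<m. x i + l * x m) *
     foldr (\<lambda>x. transfer (-1) x False) (map x [0..<m] @ [x m]) vacuum s"
    using transfer_through_fermions[of "x m" "map x [0..<m]" l s] unfolding pl .
  finally show ?case by (simp add: mult_ac)
qed

section \<open>The value at l = 0 and the product formula\<close>

lemma transfer_0_prefix:
  "transfer 0 y False F (replicate (Suc m) True @ replicate k False) =
     y ^ k * F (replicate m True @ replicate (Suc k) False)"
proof -
  \<comment> \<open>With carry \<open>False\<close> and no \<open>True\<close> bit left, no carry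
    can arise before the end, where one is required.\<close>
  have f: "transfer l y False F (replicate k False) = 0" for l y :: 'a and F k
    by (induction k arbitrary: F) simp_all
  \<comment> \<open>An entry -1 would drop the carry and give zero by \<open>f\<close>, so the carry
    crosses all \<open>k\<close> cells, each contributing \<open>y\<close>.\<close>
  have t: "transfer 0 y True F (replicate k False) = y ^ k * F (replicate k False)" for F
    by (induction k arbitrary: F) (simp_all add: f mult_ac)
  \<comment> \<open>At \<open>l = 0\<close> no carry crosses a \<open>True\<close> bit, so the entry
    1 sits at the last \<open>True\<close>, as in the identity matrix.\<close>
  show ?thesis
    by (induction m arbitrary: F) (simp_all add: f t)
qed

lemma state_sum_0:
  "m \<le> n \<Longrightarrow> state_sum 0 x m (replicate m True @ replicate (n - m) False) = (\<Prod>i<m. x i ^ (n - 1 - i))"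
proof (induction m)
  case 0
  show ?case by (simp add: vacuum_def)
next
  case (Suc m)
  have "state_sum 0 x (Suc m) (replicate (Suc m) True @ replicate (n - Suc m) False) =
     x m ^ (n - Suc m) * state_sum 0 x m (replicate m True @ replicate (Suc (n - Suc m)) False)"
    unfolding state_sum.simps transfer_0_prefix ..
  also have "Suc (n - Suc m) = n - m" using Suc.prems by simp
  finally show ?case using Suc by (simp add: mult_ac)
qed

text \<open>Comparison with \<open>l = 0\<close> determines the unknown fermion product.
  Nonvanishing and distinctness of the \<open>x i\<close> allow the two cancellations.\<close>

theorem state_sum_full:
  fixes x :: "nat \<Rightarrow> 'r::idom"
  assumes inj: "\<And>i j. i < j \<Longrightarrow> j < n \<Longrightarrow> x i \<noteq> x j" and nz: "\<And>i. i < n \<Longrightarrow> x i \<noteq> 0"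
  shows "state_sum l x n (replicate n True) = (\<Prod>j<n. \<Prod>i<j. x i + l * x j)"
proof -
  let ?D = "\<Prod>j<n. \<Prod>i<j. x j - x i"
  let ?V = "foldr (\<lambda>x. transfer (-1) x False) (map x [0..<n]) vacuum (replicate n True)"
  have D: "?D \<noteq> 0" using inj by (force simp: dest: sym)
  have X: "(\<Prod>j<n. \<Prod>i<j. x i) \<noteq> 0" using nz by auto
  \<comment> \<open>The factor \<open>x i\<close> appears once for each \<open>j\<close> with
    \<open>i < j < n\<close>.\<close>
  have "(\<Prod>j<n. \<Prod>i<j. x i) = (\<Prod>i<n. x i ^ (n - 1 - i))"
  proof (induction n)
    case (Suc n)
    have "(\<Prod>i<n. x i ^ (n - i)) = (\<Prod>i<n. x i ^ (n - 1 - i) * x i)"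
      by (intro prod.cong refl) (simp flip: power_Suc2 add: Suc_diff_Suc)
    with Suc show ?case by (simp add: prod.distrib)
  qed simp
  then have "state_sum 0 x n (replicate n True) = (\<Prod>j<n. \<Prod>i<j. x i)"
    using state_sum_0[of n n x] by simp
  \<comment> \<open>At \<open>l = 0\<close> the state sum equals the factor in front of
    \<open>?V\<close>; cancelling it leaves the Vandermonde product as the value of
    \<open>?V\<close>.\<close>
  with state_sum_eq_fermions[of x n 0 "replicate n True"] X have "?V = ?D"
    by (simp add: mult.commute)
  with state_sum_eq_fermions[of x n l "replicate n True"] D show ?thesis
    by (simp add: mult.commute)
qed


section \<open>Expansion over alternating sign matrices\<close>

text \<open>Here \<open>c\<close> is the row sum to the left of a cell, \<open>s\<close> the column
  sum above it and \<open>r\<close> the entry; the cases are the weights of \<open>transfer\<close>.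
  Integers are used so that partial sums of a matrix can be inserted directly.\<close>

definition vertex_weight :: "'r::comm_ring_1 \<Rightarrow> 'r \<Rightarrow> int \<Rightarrow> int \<Rightarrow> int \<Rightarrow> 'r" where
  "vertex_weight l y c s r =
     (if c = 1 then y * (if s = 1 then if r = -1 then 1 + l else l else 1) else 1)"

text \<open>These are the rows over which \<open>transfer\<close> implicitly sums: one list for each
  path of the carry, with the state below the row as second argument.\<close>

fun row_set :: "bool \<Rightarrow> bool list \<Rightarrow> int list set" where
  "row_set c [] = (if c then {[]} else {})"
| "row_set False (False # t) = (#) 0 ` row_set False t"
| "row_set False (True # t) = (#) 0 ` row_set False t \<union> (#) 1 ` row_set True t"
| "row_set True (False # t) = (#) 0 ` row_set True t \<union> (#) (-1) ` row_set False t"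
| "row_set True (True # t) = (#) 0 ` row_set True t"

definition prev_state :: "bool list \<Rightarrow> int list \<Rightarrow> bool list" where
  "prev_state s r = map2 (\<lambda>b e. of_bool b - e = 1) s r"

lemma vertex_weight_simps:
  "vertex_weight l y 0 s r = 1" "vertex_weight l y 1 0 r = y"
  "vertex_weight l y 1 1 0 = l * y" "vertex_weight l y 1 1 (-1) = y * (1 + l)"
  by (simp_all add: vertex_weight_def)

lemma finite_row_set: "finite (row_set c s)"
  by (induction c s rule: row_set.induct) auto

text \<open>The carry is a partial row sum, its final value 1 is the row sum, and the last conjunct
  says that the state above the row again has bits 0 and 1.\<close>

lemma row_set_iff:
  "r \<in> row_set c s \<longleftrightarrow> length r = length s \<and>
     (\<forall>j<Suc (length s). of_bool c + (\<Sum>k<j. r ! k) \<in> {0, 1}) \<and>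
     of_bool c + (\<Sum>k<length s. r ! k) = 1 \<and>
     (\<forall>j<length s. of_bool (s ! j) - r ! j \<in> {0, 1})"
proof (induction c s arbitrary: r rule: row_set.induct)
  case (1 c)
  show ?case by auto
next
  case (2 t)
  show ?case
    by (cases r) (auto simp: 2 All_less_Suc2 sum.lessThan_Suc_shift image_iff
        simp del: sum.lessThan_Suc)
next
  case (3 t)
  show ?case
    by (cases r) (auto simp: 3 All_less_Suc2 sum.lessThan_Suc_shift image_iff
        simp del: sum.lessThan_Suc)
next
  case (4 t)
  show ?case
    by (cases r) (auto simp: 4 All_less_Suc2 sum.lessThan_Suc_shift image_iff
        simp del: sum.lessThan_Suc)
next
  case (5 t)
  show ?case
    by (cases r) (auto simp: 5 All_less_Suc2 sum.lessThan_Suc_shift image_iff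
        simp del: sum.lessThan_Suc)
qed

text \<open>The recursion is unrolled. Where it branches, the two branches begin with different
  entries, so the images united in \<open>row_set\<close> are disjoint.\<close>

lemma transfer_eq_sum:
  "transfer l y c F s = (\<Sum>r\<in>row_set c s.
     (\<Prod>j<length s. vertex_weight l y (of_bool c + (\<Sum>k<j. r ! k)) (of_bool (s ! j) - r ! j) (r ! j)) *
     F (prev_state s r))"
proof (induction l y c F s rule: transfer.induct)
  case (1 l y c F)
  show ?case by (simp add: prev_state_def)
next
  case (2 l y F t)
  then show ?case
    by (simp add: sum.reindex vertex_weight_simps prev_state_def prod.lessThan_Suc_shift
        sum.lessThan_Suc_shift del: prod.lessThan_Suc sum.lessThan_Suc)
next
  case (3 l y F t)
  have "row_set False (True # t) = (#) 0 ` row_set False t \<union> (#) 1 ` row_set True t" by simp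
  with 3 show ?case
    by (subst row_set.simps, subst sum.union_disjoint)
      (auto simp add: finite_row_set sum.reindex vertex_weight_simps prev_state_def prod.lessThan_Suc_shift
        sum.lessThan_Suc_shift simp del: prod.lessThan_Suc sum.lessThan_Suc)
next
  case (4 l y F t)
  then show ?case
    by (subst row_set.simps, subst sum.union_disjoint)
      (auto simp add: finite_row_set sum.reindex vertex_weight_simps prev_state_def prod.lessThan_Suc_shift
        sum.lessThan_Suc_shift sum_distrib_left mult_ac simp del: prod.lessThan_Suc sum.lessThan_Suc)
next
  case (5 l y F t)
  then show ?case
    by (simp add: sum.reindex vertex_weight_simps prev_state_def prod.lessThan_Suc_shift
        sum.lessThan_Suc_shift sum_distrib_left mult_ac del: prod.lessThan_Suc sum.lessThan_Suc)
qed

section \<open>Stacks of rows above a given state\<close>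

primrec row_chains :: "nat \<Rightarrow> bool list \<Rightarrow> int list list set" where
  "row_chains 0 s = (if True \<in> set s then {} else {[]})"
| "row_chains (Suc m) s = (\<Union>r\<in>row_set False s. (\<lambda>R. R @ [r]) ` row_chains m (prev_state s r))"

lemma finite_row_chains: "finite (row_chains m s)"
  by (induction m arbitrary: s) (auto simp: finite_row_set)

lemma length_prev_state: "length r = length s \<Longrightarrow> length (prev_state s r) = length s"
  by (simp add: prev_state_def)

text \<open>Induction removes the last row \<open>r\<close>: the column conditions of the stack
  split into those of the shorter stack relative to \<open>prev_state s r\<close> and the bit
  condition of \<open>row_set_iff\<close> on \<open>r\<close>.\<close>

lemma row_chains_iff:
  "R \<in> row_chains m s \<longleftrightarrow> length R = m \<and> (\<forall>i<m. length (R ! i) = length s) \<and>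
     (\<forall>i<m. \<forall>j<Suc (length s). (\<Sum>k<j. R ! i ! k) \<in> {0, 1}) \<and>
     (\<forall>i<m. (\<Sum>k<length s. R ! i ! k) = 1) \<and>
     (\<forall>j<length s. \<forall>i<Suc m. (\<Sum>k<i. R ! k ! j) \<in> {0, 1}) \<and>
     (\<forall>j<length s. (\<Sum>k<m. R ! k ! j) = of_bool (s ! j))"
proof (induction m arbitrary: s R)
  case 0
  show ?case by (auto simp: in_set_conv_nth)
next
  case (Suc m)
  show ?case
  proof (cases R rule: rev_cases)
    case Nil
    then show ?thesis by auto
  next
    case (snoc R' r)
    have 1: "R \<in> row_chains (Suc m) s \<longleftrightarrow> r \<in> row_set False s \<and> R' \<in> row_chains m (prev_state s r)"
      by (auto simp: snoc)
    show ?thesis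
    proof (cases "length R' = m \<and> length r = length s")
      case False
      then show ?thesis unfolding 1 row_set_iff Suc.IH
        by (auto simp: snoc nth_append dest: spec[of _ m])
    next
      case len: True
      have col: "(\<Sum>k<i. R ! k ! j) = (\<Sum>k<i. R' ! k ! j)" if "i \<le> m" for i j
        using that len by (intro sum.cong) (auto simp: snoc nth_append)
      have row: "R ! i = R' ! i" if "i < m" for i using that len by (simp add: snoc nth_append)
      have last: "R ! m = r" using len by (simp add: snoc nth_append)
      \<comment> \<open>\<open>prev_state\<close> records only whether the difference is 1, so the
        difference is recovered once it is known to be 0 or 1.\<close>
      have prev: "of_bool (prev_state s r ! j) = of_bool (s ! j) - r ! j"
        if "of_bool (s ! j) - r ! j \<in> {0, 1}" "j < length s" for j
        using that len by (auto simp: prev_state_def)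
      have lp: "length (prev_state s r) = length s" using len by (simp add: length_prev_state)
      have cols: "(\<forall>j<length s. \<forall>i<Suc (Suc m). (\<Sum>k<i. R ! k ! j) \<in> {0, 1}) \<and>
            (\<forall>j<length s. (\<Sum>k<Suc m. R ! k ! j) = of_bool (s ! j)) \<longleftrightarrow>
          (\<forall>j<length s. of_bool (s ! j) - r ! j \<in> {0, 1}) \<and>
          (\<forall>j<length s. \<forall>i<Suc m. (\<Sum>k<i. R' ! k ! j) \<in> {0, 1}) \<and>
          (\<forall>j<length s. (\<Sum>k<m. R' ! k ! j) = of_bool (prev_state s r ! j))"
        (is "?l \<longleftrightarrow> ?r")
      proof
        assume l: ?l
        have c: "(\<Sum>k<i. R' ! k ! j) \<in> {0, 1}" if "i \<le> m" "j < length s" for i j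
        proof -
          have "(\<Sum>k<i. R ! k ! j) \<in> {0, 1}"
            using conjunct1[OF l] that by (blast intro: le_imp_less_Suc less_SucI)
          then show ?thesis using col[of i j] that by simp
        qed
        have t: "(\<Sum>k<m. R' ! k ! j) = of_bool (s ! j) - r ! j" if "j < length s" for j
          using l that col[of m j] last by auto
        have d: "of_bool (s ! j) - r ! j \<in> {0, 1}" if "j < length s" for j
          using c[of m j] t[of j] that by simp
        show ?r using c t d prev[OF d] by (simp add: less_Suc_eq_le)
      next
        assume r: ?r
        have t: "(\<Sum>k<Suc m. R ! k ! j) = of_bool (s ! j)" if "j < length s" for j
          using r that prev[of j] by (simp add: col last)
        have c: "(\<Sum>k<i. R ! k ! j) \<in> {0, 1}" if "i \<le> m" "j < length s" for i j
          using r that col[of i j] by auto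
        show ?l
        proof (intro conjI allI impI)
          fix j i assume "j < length s" "i < Suc (Suc m)"
          then show "(\<Sum>k<i. R ! k ! j) \<in> {0, 1}"
            using c[of i j] t[of j] by (cases "i = Suc m") auto
        qed (use t in auto)
      qed
      have rows: "(\<forall>i<Suc m. P (R ! i)) \<longleftrightarrow> P r \<and> (\<forall>i<m. P (R' ! i))" for P
        using row last by (auto simp: less_Suc_eq)
      show ?thesis
        unfolding 1 row_set_iff Suc.IH lp cols rows[of "\<lambda>u. length u = length s"]
          rows[of "\<lambda>u. \<forall>j<Suc (length s). (\<Sum>k<j. u ! k) \<in> {0, 1}"]
          rows[of "\<lambda>u. (\<Sum>k<length s. u ! k) = 1"]
        using len by (simp only: snoc length_append_singleton of_bool_eq add_0_left simp_thms conj_ac)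
    qed
  qed
qed

lemma state_sum_eq_sum:
  "state_sum l x m s = (\<Sum>R\<in>row_chains m s. \<Prod>i<m. \<Prod>j<length s.
     vertex_weight l (x i) (\<Sum>k<j. R ! i ! k) (\<Sum>k<i. R ! k ! j) (R ! i ! j))"
proof (induction m arbitrary: s)
  case 0
  show ?case by (simp add: vacuum_def)
next
  case (Suc m)
  let ?w = "\<lambda>R i j. vertex_weight l (x i) (\<Sum>k<j. R ! i ! k) (\<Sum>k<i. R ! k ! j) (R ! i ! j)"
  let ?row = "\<lambda>r. \<Prod>j<length s.
    vertex_weight l (x m) (\<Sum>k<j. r ! k) (of_bool (s ! j) - r ! j) (r ! j)"
  \<comment> \<open>The column sums above the last row are the bits of the previous state. Hence the
    last row contributes its factor from \<open>transfer_eq_sum\<close>, and the other rows keep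
    their weights.\<close>
  have w: "(\<Prod>i<Suc m. \<Prod>j<length s. ?w (R @ [r]) i j) = ?row r * (\<Prod>i<m. \<Prod>j<length s. ?w R i j)"
    if "r \<in> row_set False s" "R \<in> row_chains m (prev_state s r)" for r R
  proof -
    have len: "length r = length s" "length R = m"
      using that unfolding row_set_iff row_chains_iff by auto
    have ap: "(R @ [r]) ! k = (if k < m then R ! k else r)" if "k \<le> m" for k
      using that len by (auto simp: nth_append)
    have "(\<Prod>j<length s. ?w (R @ [r]) i j) = (\<Prod>j<length s. ?w R i j)" if "i < m" for i
      using that by (simp add: ap)
    moreover have "(\<Sum>k<m. (R @ [r]) ! k ! j) = of_bool (s ! j) - r ! j" if "j < length s" for j
    proof -
      have "(\<Sum>k<m. (R @ [r]) ! k ! j) = (\<Sum>k<m. R ! k ! j)" by (intro sum.cong) (auto simp: ap)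
      also have "\<dots> = of_bool (prev_state s r ! j)"
        using \<open>R \<in> _\<close> \<open>j < length s\<close> len unfolding row_chains_iff by (simp add: length_prev_state)
      also have "\<dots> = of_bool (s ! j) - r ! j"
        using \<open>r \<in> _\<close> \<open>j < length s\<close> len unfolding row_set_iff by (auto simp: prev_state_def)
      finally show ?thesis .
    qed
    ultimately show ?thesis by (simp add: ap mult.commute)
  qed
  have "state_sum l x (Suc m) s = (\<Sum>r\<in>row_set False s. ?row r * state_sum l x m (prev_state s r))"
    by (simp add: transfer_eq_sum)
  also have "\<dots> = (\<Sum>r\<in>row_set False s. \<Sum>R\<in>row_chains m (prev_state s r).
      ?row r * (\<Prod>i<m. \<Prod>j<length s. ?w R i j))"
    unfolding Suc.IH sum_distrib_left
    by (intro sum.cong refl) (auto simp: row_set_iff length_prev_state)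
  also have "\<dots> = (\<Sum>r\<in>row_set False s. \<Sum>R\<in>(\<lambda>R. R @ [r]) ` row_chains m (prev_state s r).
      \<Prod>i<Suc m. \<Prod>j<length s. ?w R i j)"
    by (rule sum.cong[OF refl]) (simp add: sum.reindex inj_on_def w del: prod.lessThan_Suc)
  \<comment> \<open>Chains with different last rows differ, so the union is disjoint.\<close>
  also have "\<dots> = (\<Sum>R\<in>row_chains (Suc m) s. \<Prod>i<Suc m. \<Prod>j<length s. ?w R i j)"
    unfolding row_chains.simps by (intro sum.UNION_disjoint[symmetric]) (auto simp: finite_row_set finite_row_chains)
  finally show ?case .
qed

section \<open>Sign alternation as a condition on partial sums\<close>

lemma alternating_iff_partial_sums:
  assumes v: "\<forall>j<n. v j \<in> {0, 1, -1}" and one: "(\<Sum>j<n. v j) = 1"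
  shows "alternating n v \<longleftrightarrow> (\<forall>j<Suc n. (\<Sum>k<j. v k) \<in> {0, 1})"
proof
  assume alt: "alternating n v"
  have "\<exists>k<n. v k \<noteq> 0"
  proof (rule ccontr)
    assume "\<not> ?thesis"
    then have "(\<Sum>j<n. v j) = 0" by (intro sum.neutral) auto
    with one show False by simp
  qed
  then obtain f where f: "f < n" "v f \<noteq> 0" "\<And>k. k < f \<Longrightarrow> v k = 0"
    using exists_least_iff[of "\<lambda>k. k < n \<and> v k \<noteq> 0"] by (metis order.strict_trans)
  have low: "(\<Sum>k<m. v k) = 0" if "m \<le> f" for m
    using that f by (intro sum.neutral) auto
  \<comment> \<open>With \<open>p\<close> the last nonzero position before \<open>m\<close>, the
    partial sum is \<open>v f\<close> if the entry at \<open>p\<close> equals the first nonzero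
    entry, and 0 otherwise.\<close>
  have inv: "\<exists>p<m. v p \<noteq> 0 \<and> (\<forall>k. p < k \<and> k < m \<longrightarrow> v k = 0) \<and>
      (\<Sum>k<m. v k) = (if v p = v f then v f else 0)" if "f < m" "m \<le> n" for m
    using Suc_leI[OF that(1)] that(2)
  proof (induction m rule: dec_induct)
    case base
    show ?case using f low[of f] by (intro exI[of _ f]) auto
  next
    case (step m)
    then obtain p where p: "p < m" "v p \<noteq> 0" "\<And>k. p < k \<Longrightarrow> k < m \<Longrightarrow> v k = 0"
      "(\<Sum>k<m. v k) = (if v p = v f then v f else 0)" by fastforce
    show ?case
    proof (cases "v m = 0")
      case True
      with p show ?thesis by (intro exI[of _ p]) (auto simp: less_Suc_eq)
    next
      case False
      have "sgn (v m) = - sgn (v p)"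
        using alt p False step.prems unfolding alternating_def by auto
      moreover have "m < n" using step.prems by simp
      then have "v m \<in> {0, 1, -1}" "v p \<in> {0, 1, -1}" "v f \<in> {0, 1, -1}"
        using v p(1) f(1) by (blast intro: less_trans)+
      ultimately show ?thesis using p f False by (intro exI[of _ m]) (auto split: if_splits)
    qed
  qed
  have val: "(\<Sum>k<m. v k) \<in> {0, v f}" if "f < m" "m \<le> n" for m
    using inv[OF that] by (elim exE conjE) (auto simp only: split: if_split)
  \<comment> \<open>The total, which is 1, lies in \<open>{0, v f}\<close>.\<close>
  with one f(1) have "v f = 1" by (metis empty_iff insert_iff order_refl zero_neq_one)
  show "\<forall>j<Suc n. (\<Sum>k<j. v k) \<in> {0, 1}"
  proof (intro allI impI)
    fix j assume "j < Suc n"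
    then show "(\<Sum>k<j. v k) \<in> {0, 1}"
      using low[of j] val[of j] \<open>v f = 1\<close> by (cases "j \<le> f") simp_all
  qed
next
  assume ps: "\<forall>j<Suc n. (\<Sum>k<j. v k) \<in> {0, 1}"
  show "alternating n v"
    unfolding alternating_def
  proof (intro allI impI, elim conjE)
    fix j k assume jk: "j < k" "k < n" "v j \<noteq> 0" "v k \<noteq> 0" "\<forall>l. j < l \<and> l < k \<longrightarrow> v l = 0"
    \<comment> \<open>Only zeros lie strictly between \<open>j\<close> and \<open>k\<close>, so two
      entries of equal sign would move the partial sum by 2, out of \<open>{0, 1}\<close>.\<close>
    have "(\<Sum>i<k. v i) = (\<Sum>i<Suc j. v i)"
      using jk by (intro sum.mono_neutral_right) auto
    then have "(\<Sum>i<k. v i) = (\<Sum>i<j. v i) + v j" "(\<Sum>i<Suc k. v i) = (\<Sum>i<k. v i) + v k" by simp_all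
    moreover have "(\<Sum>i<j. v i) \<in> {0, 1}" "(\<Sum>i<k. v i) \<in> {0, 1}" "(\<Sum>i<Suc k. v i) \<in> {0, 1}"
      using ps jk by auto
    ultimately show "sgn (v k) = - sgn (v j)" using jk by auto
  qed
qed

lemma entry_of_partial_sums:
  assumes "\<forall>j<Suc n. (\<Sum>k<j. v k) \<in> {0, 1 :: int}" "j < n"
  shows "v j \<in> {0, 1, -1}"
proof -
  have "(\<Sum>k<j. v k) \<in> {0, 1}" "(\<Sum>k<Suc j. v k) \<in> {0, 1}" using assms by auto
  then show ?thesis by auto
qed

text \<open>Partial sums in \<open>{0, 1}\<close> encode both alternation and the range of the
  entries. This is the form that matches \<open>row_chains_iff\<close>.\<close>

lemma ASM_iff:
  "A \<in> ASM n \<longleftrightarrow> A \<in> carrier_mat n n \<and>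
     (\<forall>i<n. \<forall>j<Suc n. (\<Sum>k<j. A $$ (i, k)) \<in> {0, 1}) \<and> (\<forall>i<n. (\<Sum>k<n. A $$ (i, k)) = 1) \<and>
     (\<forall>j<n. \<forall>i<Suc n. (\<Sum>k<i. A $$ (k, j)) \<in> {0, 1}) \<and> (\<forall>j<n. (\<Sum>k<n. A $$ (k, j)) = 1)"
    (is "_ \<longleftrightarrow> ?R")
proof
  assume A: "A \<in> ASM n"
  have "(\<forall>j<Suc n. (\<Sum>k<j. A $$ (i, k)) \<in> {0, 1})" if "i < n" for i
    using A that alternating_iff_partial_sums[of n "\<lambda>j. A $$ (i, j)"] unfolding ASM_def by blast
  moreover have "(\<forall>i<Suc n. (\<Sum>k<i. A $$ (k, j)) \<in> {0, 1})" if "j < n" for j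
    using A that alternating_iff_partial_sums[of n "\<lambda>i. A $$ (i, j)"] unfolding ASM_def by blast
  ultimately show ?R using A unfolding ASM_def by blast
next
  assume R: ?R
  have row: "\<forall>j<Suc n. (\<Sum>k<j. A $$ (i, k)) \<in> {0, 1}" if "i < n" for i
    using R that by blast
  have col: "\<forall>i<Suc n. (\<Sum>k<i. A $$ (k, j)) \<in> {0, 1}" if "j < n" for j
    using R that by blast
  have e: "A $$ (i, j) \<in> {0, 1, -1}" if "i < n" "j < n" for i j
    using entry_of_partial_sums[OF row] that .
  have tot: "(\<Sum>k<n. A $$ (i, k)) = 1" "(\<Sum>k<n. A $$ (k, i)) = 1" if "i < n" for i
    using R that by blast+
  have "alternating n (\<lambda>j. A $$ (i, j))" if "i < n" for i
    using alternating_iff_partial_sums[OF _ tot(1)[OF that]] row[OF that] e[OF that] by metis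
  moreover have "alternating n (\<lambda>i. A $$ (i, j))" if "j < n" for j
    using alternating_iff_partial_sums[OF _ tot(2)[OF that]] col[OF that] e[OF _ that] by metis
  ultimately show "A \<in> ASM n" using R e unfolding ASM_def
    by (intro CollectI conjI allI impI) simp_all
qed

text \<open>The full state makes every column sum 1, so \<open>row_chains_iff\<close> and
  \<open>ASM_iff\<close> impose the same conditions on a list of rows and on its matrix.\<close>

lemma sum_row_chains_eq_sum_ASM:
  "(\<Sum>R\<in>row_chains n (replicate n True). \<Prod>i<n. \<Prod>j<n.
     vertex_weight l (x i) (\<Sum>k<j. R ! i ! k) (\<Sum>k<i. R ! k ! j) (R ! i ! j)) =
   (\<Sum>A\<in>ASM n. \<Prod>i<n. \<Prod>j<n. vertex_weight l (x i) (\<Sum>k<j. A $$ (i, k)) (\<Sum>k<i. A $$ (k, j)) (A $$ (i, j)))"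
proof (rule sum.reindex_bij_witness[where j = "\<lambda>R. mat n n (\<lambda>(i, j). R ! i ! j)"
      and i = "\<lambda>A. map (\<lambda>i. map (\<lambda>j. A $$ (i, j)) [0..<n]) [0..<n]"])
  fix R assume R: "R \<in> row_chains n (replicate n True)"
  show "map (\<lambda>i. map (\<lambda>j. mat n n (\<lambda>(i, j). R ! i ! j) $$ (i, j)) [0..<n]) [0..<n] = R"
    using R unfolding row_chains_iff by (auto intro!: nth_equalityI)
  show "mat n n (\<lambda>(i, j). R ! i ! j) \<in> ASM n"
    using R unfolding row_chains_iff ASM_iff by simp
  show "(\<Prod>i<n. \<Prod>j<n. vertex_weight l (x i) (\<Sum>k<j. mat n n (\<lambda>(i, j). R ! i ! j) $$ (i, k))
      (\<Sum>k<i. mat n n (\<lambda>(i, j). R ! i ! j) $$ (k, j)) (mat n n (\<lambda>(i, j). R ! i ! j) $$ (i, j))) =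
    (\<Prod>i<n. \<Prod>j<n. vertex_weight l (x i) (\<Sum>k<j. R ! i ! k) (\<Sum>k<i. R ! k ! j) (R ! i ! j))"
    by (intro prod.cong refl) simp
next
  fix A assume A: "A \<in> ASM n"
  show "mat n n (\<lambda>(i, j). map (\<lambda>i. map (\<lambda>j. A $$ (i, j)) [0..<n]) [0..<n] ! i ! j) = A"
    using A unfolding ASM_iff by (auto intro!: eq_matI)
  show "map (\<lambda>i. map (\<lambda>j. A $$ (i, j)) [0..<n]) [0..<n] \<in> row_chains n (replicate n True)"
    using A unfolding row_chains_iff ASM_iff by simp
qed


section \<open>Weights in terms of inversions, negative entries and row moments\<close>

lemma vertex_weight_eq_powers:
  assumes "c \<in> {0, 1}" "s \<in> {0, 1}" "c + r \<in> {0, 1}" "s + r \<in> {0, 1}"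
  shows "vertex_weight l y c s r =
    y ^ nat c * l ^ nat (c * s - of_bool (r = -1)) * (1 + l) ^ of_bool (r = -1)"
    and "of_bool (r = -1) \<le> c * s"
  \<comment> \<open>An entry -1 forces \<open>c = s = 1\<close>, where the exponent of
    \<open>l\<close> becomes 0; an entry 1 forces \<open>c = s = 0\<close>.\<close>
  using assms by (auto simp: vertex_weight_def)

text \<open>The term \<open>v j\<close> is counted in each of the \<open>n - 1 - j\<close> later
  prefix sums. This turns the number of carries in a row into \<open>m_vec\<close>.\<close>

lemma sum_partial_sums:
  "(\<Sum>j<n. \<Sum>k<j. v k) = (\<Sum>j<n. v j * (int n - 1 - int j))"
proof (induction n)
  case (Suc n)
  have "(\<Sum>j<Suc n. v j * (int (Suc n) - 1 - int j)) = (\<Sum>j<n. v j * (int n - 1 - int j) + v j)"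
    by (simp add: algebra_simps)
  with Suc show ?case by (simp add: sum.distrib)
qed simp

lemma neg_count_eq_sum: "neg_count n A = (\<Sum>i<n. \<Sum>j<n. of_bool (A $$ (i, j) = -1))"
proof -
  have "neg_count n A = card {p \<in> {..<n} \<times> {..<n}. A $$ p = -1}"
    unfolding neg_count_def by (rule arg_cong[where f = card]) auto
  also have "\<dots> = (\<Sum>p\<in>{..<n} \<times> {..<n}. of_bool (A $$ p = -1))"
    by (simp only: card_eq_sum sum.inter_filter finite_cartesian_product finite_lessThan of_bool_def)
  also have "\<dots> = (\<Sum>i<n. \<Sum>j<n. of_bool (A $$ (i, j) = -1))"
    by (simp only: sum.cartesian_product case_prod_unfold prod.collapse)
  finally show ?thesis .
qed

text \<open>An inversion pairs an entry to the left of a cell with one above it. Grouping the pairs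
  by this corner cell gives the product of carry and column sum there.\<close>

lemma inv_number_eq_sum:
  "inv_number n A = (\<Sum>i<n. \<Sum>j<n. (\<Sum>k<j. A $$ (i, k)) * (\<Sum>k<i. A $$ (k, j)))"
proof -
  have "(\<Sum>i<n. \<Sum>j<n. (\<Sum>k<j. A $$ (i, k)) * (\<Sum>k<i. A $$ (k, j))) =
    (\<Sum>i<n. \<Sum>l<n. \<Sum>j<l. \<Sum>k<i. A $$ (i, j) * A $$ (k, l))"
    by (simp add: sum_product)
  also have "\<dots> = (\<Sum>(i, l, j, k)\<in>(SIGMA i:{..<n}. SIGMA l:{..<n}. {..<l} \<times> {..<i}). A $$ (i, j) * A $$ (k, l))"
    by (simp add: sum.Sigma case_prod_unfold)
  also have "\<dots> = inv_number n A"
    unfolding inv_number_def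
    by (rule sum.reindex_bij_witness[where i = "\<lambda>(i, j, k, l). (i, l, j, k)"
          and j = "\<lambda>(i, l, j, k). (i, j, k, l)"]) auto
  finally show ?thesis ..
qed

lemma m_vec_eq_sum:
  assumes "A \<in> carrier_mat n n" "i < n"
  shows "m_vec n A $ i = (\<Sum>j<n. \<Sum>k<j. A $$ (i, k))"
  using assms unfolding sum_partial_sums m_vec_def
  by (simp add: scalar_prod_def lessThan_atLeast0)

text \<open>In the product over cells the carries give the exponent of \<open>x i\<close>, the
  products of carry and column sum give the inversion number, and the entries -1 give
  \<open>neg_count\<close>.\<close>

lemma ASM_weight:
  assumes A: "A \<in> ASM n"
  shows "(\<Prod>i<n. \<Prod>j<n. vertex_weight l (x i) (\<Sum>k<j. A $$ (i, k)) (\<Sum>k<i. A $$ (k, j)) (A $$ (i, j))) =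
      l ^ nat (inv_number n A - int (neg_count n A)) * (1 + l) ^ neg_count n A *
      (\<Prod>i<n. x i ^ nat (m_vec n A $ i))"
    and "int (neg_count n A) \<le> inv_number n A"
    and "i < n \<Longrightarrow> 0 \<le> m_vec n A $ i"
proof -
  define c where "c i j = (\<Sum>k<j. A $$ (i, k))" for i j
  define s where "s i j = (\<Sum>k<i. A $$ (k, j))" for i j
  define b where "b i j = (of_bool (A $$ (i, j) = -1) :: nat)" for i j
  have carrier: "A \<in> carrier_mat n n" using A unfolding ASM_def by simp
  have R: "c i j \<in> {0, 1}" if "i < n" "j < Suc n" for i j
    using A that unfolding ASM_iff c_def by blast
  have C: "s i j \<in> {0, 1}" if "i < Suc n" "j < n" for i j
    using A that unfolding ASM_iff s_def by blast
  have S: "c i (Suc j) = c i j + A $$ (i, j)" "s (Suc i) j = s i j + A $$ (i, j)" for i j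
    by (simp_all add: c_def s_def)
  have v: "vertex_weight l (x i) (c i j) (s i j) (A $$ (i, j)) =
      x i ^ nat (c i j) * l ^ nat (c i j * s i j - int (b i j)) * (1 + l) ^ b i j"
    and le: "int (b i j) \<le> c i j * s i j" if "i < n" "j < n" for i j
    using vertex_weight_eq_powers(1)[of "c i j" "s i j" "A $$ (i, j)" l "x i"]
      vertex_weight_eq_powers(2)[of "c i j" "s i j" "A $$ (i, j)"]
      R[of i j] R[of i "Suc j"] C[of i j] C[of "Suc i" j] that unfolding S b_def by simp_all
  have c0: "0 \<le> c i j" if "i < n" "j < n" for i j using R[of i j] that by auto
  have m: "m_vec n A $ i = (\<Sum>j<n. c i j)" if "i < n" for i
    using m_vec_eq_sum[OF carrier that] by (simp add: c_def)
  have N: "neg_count n A = (\<Sum>i<n. \<Sum>j<n. b i j)" by (simp add: neg_count_eq_sum b_def)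
  have I: "inv_number n A = (\<Sum>i<n. \<Sum>j<n. c i j * s i j)"
    by (simp add: inv_number_eq_sum c_def s_def)
  \<comment> \<open>By \<open>le\<close>, applying \<open>nat\<close> cell by cell truncates
    nothing, so the exponents of \<open>l\<close> add up.\<close>
  have p: "inv_number n A - int (neg_count n A) = int (\<Sum>i<n. \<Sum>j<n. nat (c i j * s i j - int (b i j)))"
    using le by (simp add: I N flip: sum_subtractf)
  from p show "int (neg_count n A) \<le> inv_number n A" by linarith
  show "0 \<le> m_vec n A $ i" if "i < n"
    unfolding m[OF that] using c0 that by (auto intro: sum_nonneg)
  have x: "x i ^ nat (m_vec n A $ i) = (\<Prod>j<n. x i ^ nat (c i j))" if "i < n" for i
  proof -
    have "m_vec n A $ i = int (\<Sum>j<n. nat (c i j))" using c0 that by (simp add: m)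
    then show ?thesis by (simp only: nat_int power_sum)
  qed
  have "(\<Prod>i<n. \<Prod>j<n. vertex_weight l (x i) (c i j) (s i j) (A $$ (i, j))) =
      (\<Prod>i<n. \<Prod>j<n. x i ^ nat (c i j)) *
      (\<Prod>i<n. \<Prod>j<n. l ^ nat (c i j * s i j - int (b i j))) * (\<Prod>i<n. \<Prod>j<n. (1 + l) ^ b i j)"
    by (simp add: v prod.distrib)
  also have "\<dots> = l ^ nat (inv_number n A - int (neg_count n A)) * (1 + l) ^ neg_count n A *
      (\<Prod>i<n. x i ^ nat (m_vec n A $ i))"
    unfolding p nat_int by (simp add: N x power_sum)
  finally show "(\<Prod>i<n. \<Prod>j<n. vertex_weight l (x i) (\<Sum>k<j. A $$ (i, k)) (\<Sum>k<i. A $$ (k, j)) (A $$ (i, j))) =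
      l ^ nat (inv_number n A - int (neg_count n A)) * (1 + l) ^ neg_count n A *
      (\<Prod>i<n. x i ^ nat (m_vec n A $ i))"
    unfolding c_def s_def .
qed

text \<open>The hypotheses on \<open>x\<close> feed the cancellations in
  \<open>state_sum_full\<close>; the indeterminates \<open>u_pow i 1\<close> satisfy them.\<close>

theorem lambda_determinant:
  fixes x :: "nat \<Rightarrow> 'r::idom"
  assumes "\<And>i j. i < j \<Longrightarrow> j < n \<Longrightarrow> x i \<noteq> x j" and "\<And>i. i < n \<Longrightarrow> x i \<noteq> 0"
  shows "(\<Prod>j<n. \<Prod>i<j. x i + l * x j) =
    (\<Sum>A\<in>ASM n. l ^ nat (inv_number n A - int (neg_count n A)) * (1 + l) ^ neg_count n A *
      (\<Prod>i<n. x i ^ nat (m_vec n A $ i)))"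
proof -
  have "(\<Prod>j<n. \<Prod>i<j. x i + l * x j) = state_sum l x n (replicate n True)"
    using state_sum_full[of n x l] assms by simp
  also have "\<dots> = (\<Sum>A\<in>ASM n. \<Prod>i<n. \<Prod>j<n. vertex_weight l (x i)
      (\<Sum>k<j. A $$ (i, k)) (\<Sum>k<i. A $$ (k, j)) (A $$ (i, j)))"
    unfolding state_sum_eq_sum length_replicate by (rule sum_row_chains_eq_sum_ASM)
  finally show ?thesis by (simp add: ASM_weight(1) cong: sum.cong)
qed

section \<open>The constant term\<close>

lemma CT_laurent_times_superset:
  assumes "finite S" "Poly_Mapping.keys P \<subseteq> S"
  shows "CT (laurent_times P D) f = (\<Sum>k\<in>S. rf_const (Poly_Mapping.lookup P k) * D (- k) f)"
  unfolding CT_def laurent_times_def using assms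
  by (auto intro!: sum.mono_neutral_left simp: in_keys_iff rf_const_simps)

lemma CT_laurent_times_add:
  "CT (laurent_times (P + Q) D) f = CT (laurent_times P D) f + CT (laurent_times Q D) f"
proof -
  let ?S = "Poly_Mapping.keys P \<union> Poly_Mapping.keys Q"
  have "Poly_Mapping.keys (P + Q) \<subseteq> ?S" by (rule Poly_Mapping.keys_add)
  then show ?thesis
    by (simp add: CT_laurent_times_superset[where S = ?S] lookup_add rf_const_simps algebra_simps
        sum.distrib)
qed

lemma CT_laurent_times_single:
  "CT (laurent_times (Poly_Mapping.single k c) D) f = rf_const c * D (- k) f"
  by (subst CT_laurent_times_superset[where S = "{k}"]) auto

text \<open>Against a monomial of exponent \<open>k\<close> the constant term selects the
  coefficient of \<open>D\<close> at \<open>- k\<close>; additivity does the rest.\<close>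

lemma CT_laurent_times_sum:
  "CT (laurent_times (\<Sum>A\<in>S. Poly_Mapping.single (e A) (c A)) D) f =
     (\<Sum>A\<in>S. rf_const (c A) * D (- e A) f)"
proof (induction S rule: infinite_finite_induct)
  case (infinite S)
  then show ?case by (simp add: CT_def laurent_times_def)
next
  case empty
  show ?case by (simp add: CT_def laurent_times_def)
qed (simp add: CT_laurent_times_add CT_laurent_times_single)

lemma u_pow_power: "u_pow i e ^ k = u_pow i (int k * e)"
  by (induction k) (simp_all add: u_pow_def mult_single algebra_simps flip: single_add single_one)

lemma u_pow_mult: "u_pow i d * u_pow i e = u_pow i (d + e)"
  by (simp add: u_pow_def mult_single flip: single_add)

lemma prod_u_pow:
  "(\<Prod>i<n. u_pow i (e i)) = Poly_Mapping.single (\<Sum>i<n. Poly_Mapping.single i (e i)) 1"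
  by (induction n) (simp_all add: u_pow_def mult_single add.commute)

lemma const_power: "Poly_Mapping.single 0 c ^ k = (Poly_Mapping.single 0 (c ^ k) :: 'k::field_char_0 laurent)"
  by (induction k) (simp_all add: mult_single)

text \<open>Once denominators are cleared, the kernel is a Laurent monomial times the product in
  \<open>lambda_determinant\<close>, taken in the Laurent ring with the constant
  \<open>- q_var\<close> as \<open>l\<close>.\<close>

lemma qdet_kernel_eq_sum:
  "qdet_kernel \<alpha> a = (\<Sum>A\<in>ASM \<alpha>. Poly_Mapping.single
     (\<Sum>i<\<alpha>. Poly_Mapping.single i (m_vec \<alpha> A $ i - (a i + int \<alpha> - 1 - int i)))
     ((- q_var) ^ nat (inv_number \<alpha> A - int (neg_count \<alpha> A)) * (1 - q_var) ^ neg_count \<alpha> A))"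
proof -
  define u where "u = (\<lambda>i. u_pow i 1 :: 'a laurent)"
  define l where "l = (Poly_Mapping.single 0 (- q_var) :: 'a laurent)"
  have u_inj: "u i \<noteq> u j" if "i < j" for i j
  proof
    assume "u i = u j"
    then have "Poly_Mapping.keys (u i) = Poly_Mapping.keys (u j)" by simp
    then have "Poly_Mapping.single i (1::int) = Poly_Mapping.single j 1"
      by (simp add: u_def u_pow_def)
    then have "Poly_Mapping.keys (Poly_Mapping.single i (1::int)) = Poly_Mapping.keys (Poly_Mapping.single j (1::int))"
      by (simp only:)
    with that show False by simp
  qed
  have u_nz: "u i \<noteq> 0" for i
  proof -
    have "Poly_Mapping.keys (u i) \<noteq> {}" by (simp add: u_def u_pow_def)
    then show ?thesis by auto
  qed
  have factor: "1 - Poly_Mapping.single 0 q_var * u_pow j 1 * u_pow i (-1) =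
      u_pow i (-1) * (u i + l * u j)" for i j
  proof -
    have "u_pow i (-1) * u i = 1" unfolding u_def u_pow_mult by (simp add: u_pow_def)
    moreover have "l = - Poly_Mapping.single 0 q_var" by (simp add: l_def single_uminus)
    ultimately show ?thesis by (simp add: right_diff_distrib u_def mult_ac)
  qed
  have pairs: "(\<Prod>(i, j)\<in>{(i, j). i < j \<and> j < \<alpha>}. g i j) = (\<Prod>j<\<alpha>. \<Prod>i<j. g i j)"
    for g :: "nat \<Rightarrow> nat \<Rightarrow> 'a laurent"
  proof -
    have "(\<Prod>j<\<alpha>. \<Prod>i<j. g i j) = (\<Prod>(j, i)\<in>(SIGMA j:{..<\<alpha>}. {..<j}). g i j)"
      by (simp add: prod.Sigma)
    also have "\<dots> = (\<Prod>(i, j)\<in>{(i, j). i < j \<and> j < \<alpha>}. g i j)"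
      by (rule prod.reindex_bij_witness[where i = "\<lambda>(i, j). (j, i)" and j = "\<lambda>(i, j). (j, i)"]) auto
    finally show ?thesis ..
  qed
  \<comment> \<open>The denominator \<open>u_pow i 1\<close> occurs once for each \<open>j\<close>
    with \<open>i < j < n\<close>; this is the source of the shift \<open>n - 1 - i\<close>, which
    is \<open>n - i\<close> in 1-based indices.\<close>
  have inv: "(\<Prod>j<n. \<Prod>i<j. u_pow i (-1)) = (\<Prod>i<n. u_pow i (- (int n - 1 - int i)) :: 'a laurent)" for n
  proof (induction n)
    case (Suc n)
    have "(\<Prod>i<n. u_pow i (- (int (Suc n) - 1 - int i))) =
        (\<Prod>i<n. u_pow i (- (int n - 1 - int i)) * u_pow i (-1) :: 'a laurent)"
      by (simp add: u_pow_mult algebra_simps)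
    with Suc show ?case by (simp add: prod.distrib) (simp add: u_pow_def)
  qed simp
  have "qdet_kernel \<alpha> a = (\<Prod>i<\<alpha>. u_pow i (- a i)) *
      (\<Prod>i<\<alpha>. u_pow i (- (int \<alpha> - 1 - int i))) * (\<Prod>j<\<alpha>. \<Prod>i<j. u i + l * u j)"
    unfolding qdet_kernel_def pairs factor prod.distrib inv by (simp add: mult_ac)
  also have "\<dots> = (\<Prod>i<\<alpha>. u_pow i (- (a i + int \<alpha> - 1 - int i))) * (\<Prod>j<\<alpha>. \<Prod>i<j. u i + l * u j)"
    by (simp add: u_pow_mult algebra_simps flip: prod.distrib)
  also have "\<dots> = (\<Sum>A\<in>ASM \<alpha>. (\<Prod>i<\<alpha>. u_pow i (- (a i + int \<alpha> - 1 - int i))) *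
      (l ^ nat (inv_number \<alpha> A - int (neg_count \<alpha> A)) * (1 + l) ^ neg_count \<alpha> A *
      (\<Prod>i<\<alpha>. u i ^ nat (m_vec \<alpha> A $ i))))"
    using lambda_determinant[of \<alpha> u l] u_inj u_nz by (simp add: sum_distrib_left)
  also have "\<dots> = (\<Sum>A\<in>ASM \<alpha>. Poly_Mapping.single
     (\<Sum>i<\<alpha>. Poly_Mapping.single i (m_vec \<alpha> A $ i - (a i + int \<alpha> - 1 - int i)))
     ((- q_var) ^ nat (inv_number \<alpha> A - int (neg_count \<alpha> A)) * (1 - q_var) ^ neg_count \<alpha> A))"
  proof (rule sum.cong[OF refl])
    fix A assume A: "A \<in> ASM \<alpha>"
    let ?I = "nat (inv_number \<alpha> A - int (neg_count \<alpha> A))" and ?N = "neg_count \<alpha> A"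
    have l1: "1 + l = Poly_Mapping.single 0 (1 - q_var)"
      unfolding l_def by (simp flip: single_one single_add)
    have "(\<Prod>i<\<alpha>. u_pow i (- (a i + int \<alpha> - 1 - int i))) * (l ^ ?I * (1 + l) ^ ?N *
        (\<Prod>i<\<alpha>. u i ^ nat (m_vec \<alpha> A $ i))) =
      l ^ ?I * (1 + l) ^ ?N *
        (\<Prod>i<\<alpha>. u_pow i (- (a i + int \<alpha> - 1 - int i)) * u i ^ nat (m_vec \<alpha> A $ i))"
      unfolding prod.distrib by (simp only: mult_ac)
    \<comment> \<open>Nonnegativity of \<open>m_vec\<close> turns the natural power of
      \<open>u i\<close> into an integer exponent.\<close>
    also have "(\<Prod>i<\<alpha>. u_pow i (- (a i + int \<alpha> - 1 - int i)) * u i ^ nat (m_vec \<alpha> A $ i)) =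
        (\<Prod>i<\<alpha>. u_pow i (m_vec \<alpha> A $ i - (a i + int \<alpha> - 1 - int i)))"
      using ASM_weight(3)[OF A] by (intro prod.cong refl) (simp add: u_def u_pow_power u_pow_mult algebra_simps)
    also have "l ^ ?I * (1 + l) ^ ?N * \<dots> = Poly_Mapping.single
       (\<Sum>i<\<alpha>. Poly_Mapping.single i (m_vec \<alpha> A $ i - (a i + int \<alpha> - 1 - int i)))
       ((- q_var) ^ ?I * (1 - q_var) ^ ?N)"
      unfolding l1 unfolding l_def prod_u_pow const_power mult_single by simp
    finally show "(\<Prod>i<\<alpha>. u_pow i (- (a i + int \<alpha> - 1 - int i))) * (l ^ ?I * (1 + l) ^ ?N *
        (\<Prod>i<\<alpha>. u i ^ nat (m_vec \<alpha> A $ i))) = Poly_Mapping.single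
       (\<Sum>i<\<alpha>. Poly_Mapping.single i (m_vec \<alpha> A $ i - (a i + int \<alpha> - 1 - int i)))
       ((- q_var) ^ ?I * (1 - q_var) ^ ?N)" .
  qed
  finally show ?thesis .
qed

section \<open>Reading off the operator products\<close>

lemma M_prod_cong:
  "(\<And>i. i < \<alpha> \<Longrightarrow> b i = c i) \<Longrightarrow> M_prod N \<alpha> b = M_prod N \<alpha> c"
  unfolding M_prod_def by (rule arg_cong[where f = "\<lambda>xs. foldr (\<circ>) xs id"]) simp

text \<open>Taking the constant term negates the exponents of the kernel. The negated exponent
  vector vanishes from index \<open>\<alpha>\<close> on, so the support test in
  \<open>m_product\<close> succeeds.\<close>

lemma m_product_uminus_sum:
  "m_product N \<alpha> (- (\<Sum>i<\<alpha>. Poly_Mapping.single i (- e i))) = M_prod N \<alpha> e"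
proof -
  let ?n = "- (\<Sum>i<\<alpha>. Poly_Mapping.single i (- e i)) :: nat \<Rightarrow>\<^sub>0 int"
  have l: "Poly_Mapping.lookup ?n i = (if i < \<alpha> then e i else 0)" for i
    by (simp add: lookup_sum lookup_single when_def sum_negf)
  have "Poly_Mapping.keys ?n \<subseteq> {..<\<alpha>}"
    unfolding subset_iff in_keys_iff l by simp
  then show ?thesis
    unfolding m_product_def l by (simp cong: M_prod_cong)
qed

theorem theorem7p3:
  fixes N \<alpha> :: nat and a :: "nat \<Rightarrow> int" and f :: "'k::field_char_0 ratfun"
  assumes "1 \<le> \<alpha>" and "\<alpha> \<le> N" and "f \<in> sym_ratfuns N"
  shows "qdet N \<alpha> a f = (\<Sum>A\<in>ASM \<alpha>.
    rf_const ((- q_var) powi (inv_number \<alpha> A - int (neg_count \<alpha> A)) * (1 - q_var) ^ neg_count \<alpha> A) *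
    M_prod N \<alpha> (\<lambda>i. a i + int \<alpha> - 1 - int i - m_vec \<alpha> A $ i) f)"
  unfolding qdet_def qdet_kernel_eq_sum CT_laurent_times_sum
proof (rule sum.cong[OF refl])
  fix A assume A: "A \<in> ASM \<alpha>"
  let ?e = "\<lambda>i. a i + int \<alpha> - 1 - int i - m_vec \<alpha> A $ i"
  \<comment> \<open>The exponent is nonnegative, so the integer power agrees with the
    \<open>nat\<close> power from the kernel.\<close>
  have "(- q_var) powi (inv_number \<alpha> A - int (neg_count \<alpha> A)) =
      (- q_var :: 'k poly fract) ^ nat (inv_number \<alpha> A - int (neg_count \<alpha> A))"
    using ASM_weight(2)[OF A] by (simp add: power_int_def)
  then show "rf_const ((- q_var) ^ nat (inv_number \<alpha> A - int (neg_count \<alpha> A)) *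
        (1 - q_var) ^ neg_count \<alpha> A) *
      m_product N \<alpha> (- (\<Sum>i<\<alpha>. Poly_Mapping.single i (m_vec \<alpha> A $ i - (a i + int \<alpha> - 1 - int i)))) f =
    rf_const ((- q_var) powi (inv_number \<alpha> A - int (neg_count \<alpha> A)) * (1 - q_var) ^ neg_count \<alpha> A) *
      M_prod N \<alpha> ?e f"
    using fun_cong[OF m_product_uminus_sum[of N \<alpha> ?e], of f] by simp
qed

end
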